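(* Let $N>1$. For every $\alpha>0$, the probability function $Q$ of QCARE with parameter $\alpha$ is anonymous, recurrent, leading-arm convergent, and unradical. When $\alpha\in(0,0.5)$, it is $\alpha$-exploratory. When $\alpha\in(0.5,+\infty)$, it is $\alpha$-irreversible.
   Context: States are $S=(\kappa,u)\in\mathbb Z_+^N\times[0,1]^N$, with $\mathbb Z_+=\{0,1,2,\dots\}$ ($\kappa_i$ is the pull count and $u_i$ the empirical reward of arm $i\in[N]=\{1,\dots,N\}$ in the $N$-armed bandit problem). The probability function of QCARE with parameter $\alpha$ is $Q=(Q_1,\dots,Q_N)$, where $Q_i(\kappa,u)=\Pr(\theta_i\ge\theta_j\text{ for all }j)$ with $\theta_i=u_i+\frac{\epsilon_i}{(\kappa_i+1)^\alpha}$ and $\epsilon_1,\dots,\epsilon_N$ independent standard normal. Write $S^i=(\kappa_i,u_i)$, $S^{-i}$ for the state values of the other arms, and $Q_i(S)=Q_i(S^i;S^{-i})$. Definitions for a function $Q$ from states to probability vectors on $[N]$: Anonymous: for every permutation $\sigma$ of $[N]$, every $i$ and every state, $Q_i(\kappa_{\sigma(1)},\dots,\kappa_{\sigma(N)},u_{\sigma(1)},\dots,u_{\sigma(N)})=Q_{\sigma(i)}(\kappa_1,\dots,\kappa_N,u_1,\dots,u_N)$. Recurrent: for every $S^1=(\kappa_1,u_1)\in\mathbb Z_+\times[0,1]$ there exists $\varepsilon>0$ (possibly depending on $S^1$) with $Q_1(S^1;S^{-1})\ge\varepsilon$ for all $S^{-1}$. Leading-arm convergent: for every sequence of states $(\kappa,u)=(\kappa(T),u(T))$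 with $\kappa_i=\omega(1)$ for every $i\in[N]$ and $u_1-u_i=\Omega(1)$ for every $i\ge2$, one has $1-Q_1(\kappa,u)=o(1)$. Unradical: $Q_1(\kappa,u)\le\frac12$ for every $\kappa\in\mathbb Z_+^N$ and $u\in[0,1]^N$ with $u_1\le\min\{u_2,\dots,u_N\}$. $\alpha$-exploratory (for $\alpha\in(0,0.5)$): there exist constants $\varepsilon>0$, $\delta\in(0,1)$ and a sequence $\Delta_1,\Delta_2,\dots$ with $\Delta_T=\Omega(T^{-\alpha})$ such that for all sufficiently large $T$, all $u_1\in[0,1]$ with $u_1\le\Delta_T$, and all $\kappa\in\mathbb Z_+^N$ with $\sum_{i>1}\kappa_i<\delta T$, one has $1-Q_1(\kappa_1,\dots,\kappa_N,u_1,0,\dots,0)\ge\varepsilon$. $\alpha$-irreversible (for $\alpha>0.5$): for every constant $\delta\in(0,2\alpha)$ (however small), every arm $j>1$, every sequence $u=u(T)\in[0,1]^N$ with $u_j-u_1=\Omega(1)$, and every sequence $\kappa=\kappa(T)\in\mathbb Z_+^N$ with $\kappa_1,\kappa_j\ge(\log T)^{\frac{1}{2\alpha-\delta}}$ for all sufficiently large $T$, one has $Q_1(\kappa,u)\le\frac{(\log T)^{1/(2\alpha-\delta)}}{T}$ for all sufficiently large $T$. Notation (as $T\to\infty$): $f=o(g)$ means $\limsup f/g=0$; $f=\Omega(g)$ means $\liminf f/g>0$; $f=\omega(g)$ means $\liminf f/g=\infty$. *)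

theory Defs
  imports "HOL-Probability.Probability" "HOL-Combinatorics.Permutations"
begin

text \<open>
  Arms are the indices \<open>1, \<dots>, N\<close>. Vectors indexed by the arms are functions that are
  \<open>undefined\<close> outside \<open>{1..N}\<close>, so that a state carries exactly the data \<open>(\<kappa>, u)\<close>.
\<close>

type_synonym state = "(nat \<Rightarrow> nat) \<times> (nat \<Rightarrow> real)"

definition pull_counts :: "nat \<Rightarrow> (nat \<Rightarrow> nat) set" where
  "pull_counts N = ({1..N} \<rightarrow>\<^sub>E UNIV)"

definition rewards :: "nat \<Rightarrow> (nat \<Rightarrow> real) set" where
  "rewards N = ({1..N} \<rightarrow>\<^sub>E {0..1})"

definition states :: "nat \<Rightarrow> state set" where
  "states N = pull_counts N \<times> rewards N"

definition std_normal :: "real measure" where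
  "std_normal = density lborel std_normal_density"

definition perturbed_reward :: "real \<Rightarrow> state \<Rightarrow> (nat \<Rightarrow> real) \<Rightarrow> nat \<Rightarrow> real" where
  "perturbed_reward \<alpha> = (\<lambda>(\<kappa>, u) \<epsilon> i. u i + \<epsilon> i / (real (\<kappa> i) + 1) powr \<alpha>)"

definition qcare :: "nat \<Rightarrow> real \<Rightarrow> state \<Rightarrow> nat \<Rightarrow> real" where
  "qcare N \<alpha> S i =
     \<P>(\<epsilon> in PiM {1..N} (\<lambda>_. std_normal).
        \<forall>j\<in>{1..N}. perturbed_reward \<alpha> S \<epsilon> i \<ge> perturbed_reward \<alpha> S \<epsilon> j)"

text \<open>
  The asymptotic notations are about the signed quotient \<open>f / g\<close>. In particular \<open>is_Omega f g\<close>
  forces \<open>f\<close> to have eventually the sign of \<open>g\<close>, which the \<open>\<Omega>\<close> of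
  \<^theory>\<open>HOL-Library.Landau_Symbols\<close>, defined through norms, does not.
\<close>

definition is_o :: "(nat \<Rightarrow> real) \<Rightarrow> (nat \<Rightarrow> real) \<Rightarrow> bool" where
  "is_o f g \<longleftrightarrow> limsup (\<lambda>T. ereal (f T / g T)) = 0"

definition is_Omega :: "(nat \<Rightarrow> real) \<Rightarrow> (nat \<Rightarrow> real) \<Rightarrow> bool" where
  "is_Omega f g \<longleftrightarrow> liminf (\<lambda>T. ereal (f T / g T)) > 0"

definition is_omega :: "(nat \<Rightarrow> real) \<Rightarrow> (nat \<Rightarrow> real) \<Rightarrow> bool" where
  "is_omega f g \<longleftrightarrow> liminf (\<lambda>T. ereal (f T / g T)) = \<infinity>"

definition anonymous :: "nat \<Rightarrow> (state \<Rightarrow> nat \<Rightarrow> real) \<Rightarrow> bool" where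
  "anonymous N Q \<longleftrightarrow>
     (\<forall>\<sigma> i \<kappa> u. \<sigma> permutes {1..N} \<longrightarrow> i \<in> {1..N} \<longrightarrow> (\<kappa>, u) \<in> states N \<longrightarrow>
        Q (\<kappa> \<circ> \<sigma>, u \<circ> \<sigma>) i = Q (\<kappa>, u) (\<sigma> i))"

definition recurrent :: "nat \<Rightarrow> (state \<Rightarrow> nat \<Rightarrow> real) \<Rightarrow> bool" where
  "recurrent N Q \<longleftrightarrow>
     (\<forall>k (v::real). v \<in> {0..1} \<longrightarrow>
        (\<exists>\<epsilon>>0. \<forall>\<kappa> u. (\<kappa>, u) \<in> states N \<longrightarrow> \<kappa> 1 = k \<longrightarrow> u 1 = v \<longrightarrow> Q (\<kappa>, u) 1 \<ge> \<epsilon>))"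

definition leading_arm_convergent :: "nat \<Rightarrow> (state \<Rightarrow> nat \<Rightarrow> real) \<Rightarrow> bool" where
  "leading_arm_convergent N Q \<longleftrightarrow>
     (\<forall>\<kappa> u. (\<forall>T. (\<kappa> T, u T) \<in> states N) \<longrightarrow>
        (\<forall>i\<in>{1..N}. is_omega (\<lambda>T. real (\<kappa> T i)) (\<lambda>_. 1)) \<longrightarrow>
        (\<forall>i\<in>{2..N}. is_Omega (\<lambda>T. u T 1 - u T i) (\<lambda>_. 1)) \<longrightarrow>
        is_o (\<lambda>T. 1 - Q (\<kappa> T, u T) 1) (\<lambda>_. 1))"

definition unradical :: "nat \<Rightarrow> (state \<Rightarrow> nat \<Rightarrow> real) \<Rightarrow> bool" where
  "unradical N Q \<longleftrightarrow>
     (\<forall>\<kappa> u. (\<kappa>, u) \<in> states N \<longrightarrow> u 1 \<le> Min (u ` {2..N}) \<longrightarrow> Q (\<kappa>, u) 1 \<le> 1 / 2)"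

definition exploratory :: "nat \<Rightarrow> real \<Rightarrow> (state \<Rightarrow> nat \<Rightarrow> real) \<Rightarrow> bool" where
  "exploratory N \<alpha> Q \<longleftrightarrow>
     (\<exists>\<epsilon>>0. \<exists>\<delta>\<in>{0<..<1}. \<exists>\<Delta>.
        is_Omega \<Delta> (\<lambda>T. real T powr (- \<alpha>)) \<and>
        (\<forall>\<^sub>F T in sequentially.
           \<forall>v\<in>{0..1}. v \<le> \<Delta> T \<longrightarrow>
             (\<forall>\<kappa>\<in>pull_counts N. real (\<Sum>i\<in>{2..N}. \<kappa> i) < \<delta> * real T \<longrightarrow>
                1 - Q (\<kappa>, \<lambda>i\<in>{1..N}. if i = 1 then v else 0) 1 \<ge> \<epsilon>)))"

definition irreversible :: "nat \<Rightarrow> real \<Rightarrow> (state \<Rightarrow> nat \<Rightarrow> real) \<Rightarrow> bool" where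
  "irreversible N \<alpha> Q \<longleftrightarrow>
     (\<forall>\<delta>\<in>{0<..<2 * \<alpha>}. \<forall>j\<in>{2..N}. \<forall>\<kappa> u.
        (\<forall>T. (\<kappa> T, u T) \<in> states N) \<longrightarrow>
        is_Omega (\<lambda>T. u T j - u T 1) (\<lambda>_. 1) \<longrightarrow>
        (\<forall>\<^sub>F T in sequentially.
           real (\<kappa> T 1) \<ge> ln (real T) powr (1 / (2 * \<alpha> - \<delta>)) \<and>
           real (\<kappa> T j) \<ge> ln (real T) powr (1 / (2 * \<alpha> - \<delta>))) \<longrightarrow>
        (\<forall>\<^sub>F T in sequentially.
           Q (\<kappa> T, u T) 1 \<le> ln (real T) powr (1 / (2 * \<alpha> - \<delta>)) / real T))"

lemma prob_space_std_normal: "prob_space std_normal"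
  unfolding std_normal_def by (rule prob_space_normal_density) simp

lemma sets_std_normal [measurable_cong, simp]: "sets std_normal = sets borel"
  by (simp add: std_normal_def)

lemma space_std_normal [simp]: "space std_normal = UNIV"
  by (simp add: std_normal_def)

lemma perturbed_reward_measurable [measurable]:
  assumes "i \<in> {1..N}"
  shows "(\<lambda>\<epsilon>. perturbed_reward \<alpha> S \<epsilon> i) \<in> borel_measurable (PiM {1..N} (\<lambda>_. std_normal))"
proof -
  have [measurable]: "(\<lambda>\<epsilon>. \<epsilon> i) \<in> borel_measurable (PiM {1..N} (\<lambda>_. std_normal))"
    using measurable_component_singleton[OF assms, of "\<lambda>_. std_normal"]
    by (simp add: measurable_cong_sets[OF refl sets_std_normal])
  show ?thesis unfolding perturbed_reward_def split_beta by measurable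
qed

lemma perturbed_reward_no_ties:
  assumes ij: "i \<in> {1..N}" "j \<in> {1..N}" "i \<noteq> j"
  shows "AE \<epsilon> in PiM {1..N} (\<lambda>_. std_normal).
           perturbed_reward \<alpha> S \<epsilon> i \<noteq> perturbed_reward \<alpha> S \<epsilon> j"
proof -
  let ?M = "PiM {1..N} (\<lambda>_. std_normal)"
  let ?I = "{1..N} - {i}"
  let ?\<theta> = "perturbed_reward \<alpha> S"
  let ?tie = "{\<epsilon> \<in> space ?M. ?\<theta> \<epsilon> i = ?\<theta> \<epsilon> j}"
  interpret product_sigma_finite "\<lambda>_::nat. std_normal"
    by unfold_locales (rule sigma_finite_measure.sigma_finite_countable[
        OF prob_space_imp_sigma_finite[OF prob_space_std_normal]])
  have [measurable]: "(\<lambda>\<epsilon>. ?\<theta> \<epsilon> i) \<in> borel_measurable ?M" "(\<lambda>\<epsilon>. ?\<theta> \<epsilon> j) \<in> borel_measurable ?M"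
    using ij perturbed_reward_measurable by blast+
  have tie: "?tie \<in> sets ?M"
    by (rule borel_measurable_eq) fact+
  have ins: "insert i ?I = {1..N}" using ij by auto
  have null: "emeasure std_normal {y} = 0" for y
  proof -
    have "AE x in std_normal. x \<noteq> y"
      unfolding std_normal_def by (subst AE_density) (auto intro: eventually_mono[OF AE_lborel_singleton[of y]])
    then show ?thesis by (subst (asm) AE_iff_measurable[OF _ refl]) auto
  qed
  have inner: "(\<integral>\<^sup>+ y. indicator ?tie (x(i := y)) \<partial>std_normal) = 0" for x
  proof -
    obtain y0 where y0: "\<And>y. ?\<theta> (x(i := y)) i = ?\<theta> (x(i := y)) j \<Longrightarrow> y = y0"
    proof
      fix y
      let ?c = "(real (fst S i) + 1) powr \<alpha>"
      assume "?\<theta> (x(i := y)) i = ?\<theta> (x(i := y)) j"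
      moreover have "?c \<noteq> 0" by simp
      ultimately show "y = (snd S j + x j / (real (fst S j) + 1) powr \<alpha> - snd S i) * ?c"
        using ij by (simp add: perturbed_reward_def split_beta field_simps)
    qed
    have "(\<integral>\<^sup>+ y. indicator ?tie (x(i := y)) \<partial>std_normal) \<le> (\<integral>\<^sup>+ y. indicator {y0} y \<partial>std_normal)"
      using y0 by (intro nn_integral_mono) (auto split: split_indicator)
    also have "\<dots> = 0" using null by simp
    finally show ?thesis by simp
  qed
  have "emeasure ?M ?tie = (\<integral>\<^sup>+ \<epsilon>. indicator ?tie \<epsilon> \<partial>PiM (insert i ?I) (\<lambda>_. std_normal))"
    unfolding ins using tie by simp
  also have "\<dots> = (\<integral>\<^sup>+ x. (\<integral>\<^sup>+ y. indicator ?tie (x(i := y)) \<partial>std_normal) \<partial>PiM ?I (\<lambda>_. std_normal))"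
    by (rule product_nn_integral_insert) (use tie ins in auto)
  also have "\<dots> = 0" unfolding inner by simp
  finally show ?thesis
    using tie by (subst AE_iff_measurable[OF tie]) auto
qed

text \<open>Ties are null, so \<open>qcare\<close> does take values in the probability vectors on the arms.\<close>

lemma qcare_nonneg: "qcare N \<alpha> S i \<ge> 0"
  by (simp add: qcare_def)

lemma sum_qcare:
  assumes "N \<ge> 1"
  shows "(\<Sum>i\<in>{1..N}. qcare N \<alpha> S i) = 1"
proof -
  let ?M = "PiM {1..N} (\<lambda>_. std_normal)"
  let ?\<theta> = "perturbed_reward \<alpha> S"
  let ?A = "\<lambda>i. {\<epsilon> \<in> space ?M. \<forall>j\<in>{1..N}. ?\<theta> \<epsilon> i \<ge> ?\<theta> \<epsilon> j}"
  interpret prob_space ?M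
    by (intro prob_space_PiM prob_space_std_normal)
  have meas: "?A i \<in> events" if "i \<in> {1..N}" for i
    by (intro sets.sets_Collect_finite_All' borel_measurable_le perturbed_reward_measurable that)
       (use assms in auto)
  have "AE \<epsilon> in ?M. \<forall>i\<in>{1..N}. \<forall>j\<in>{1..N} - {i}. ?\<theta> \<epsilon> i \<noteq> ?\<theta> \<epsilon> j"
    by (intro AE_finite_allI perturbed_reward_no_ties) auto
  then have one: "AE \<epsilon> in ?M. (\<Sum>i\<in>{1..N}. indicator (?A i) \<epsilon>) = (1::real)"
    using AE_space
  proof eventually_elim
    case (elim \<epsilon>)
    have ne: "{1..N} \<noteq> {}" using assms by auto
    have "Max (?\<theta> \<epsilon> ` {1..N}) \<in> ?\<theta> \<epsilon> ` {1..N}"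
      by (rule Max_in) (use ne in simp_all)
    then obtain i where i: "i \<in> {1..N}" "?\<theta> \<epsilon> i = Max (?\<theta> \<epsilon> ` {1..N})"
      by (metis imageE)
    have max: "?\<theta> \<epsilon> k \<le> ?\<theta> \<epsilon> i" if "k \<in> {1..N}" for k
      using that i by simp
    have "indicator (?A k) \<epsilon> = (if k = i then 1 else 0::real)" if "k \<in> {1..N}" for k
    proof (cases "k = i")
      case True
      then show ?thesis using max elim by (simp add: indicator_def)
    next
      case False
      then have "\<not> ?\<theta> \<epsilon> k \<ge> ?\<theta> \<epsilon> i" using max[OF that] elim that i(1) by force
      then show ?thesis using i(1) False by (auto simp: indicator_def)
    qed
    then have "(\<Sum>k\<in>{1..N}. indicator (?A k) \<epsilon>) = (\<Sum>k\<in>{1..N}. if k = i then 1 else 0::real)"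
      by (intro sum.cong) auto
    also have "\<dots> = 1" using i(1) by simp
    finally show ?case .
  qed
  have "(\<Sum>i\<in>{1..N}. qcare N \<alpha> S i) = (\<Sum>i\<in>{1..N}. \<integral>\<epsilon>. indicator (?A i) \<epsilon> \<partial>?M)"
    using meas by (intro sum.cong) (auto simp: qcare_def)
  also have "\<dots> = (\<integral>\<epsilon>. (\<Sum>i\<in>{1..N}. indicator (?A i) \<epsilon>) \<partial>?M)"
    by (intro Bochner_Integration.integral_sum[symmetric] integrable_real_indicator meas)
       (simp_all add: emeasure_eq_measure del: One_nat_def)
  also have "\<dots> = (\<integral>\<epsilon>. 1 \<partial>?M)"
    by (rule integral_cong_AE) (use meas one in auto)
  also have "\<dots> = 1" by (simp add: prob_space del: One_nat_def)
  finally show ?thesis .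
qed

end

theory Submission
  imports Defs "HOL-Real_Asymp.Real_Asymp"
begin

text \<open>
  Everything reduces to two facts about a standard normal variable: it charges every interval, and
  \<open>Pr(\<epsilon> \<ge> t) \<le> exp (- t\<^sup>2 / 2)\<close> for \<open>t \<ge> 0\<close>. Recurrence and exploration
  follow by forcing the comparison of the perturbed rewards on a box of positive probability. For
  convergence and irreversibility, if arm \<open>i\<close> trails arm \<open>j\<close> by \<open>c\<close>, then
  \<open>\<theta>\<^sub>i \<ge> \<theta>\<^sub>j\<close> requires one of the two perturbations to exceed \<open>c / 2\<close>.
  Unradicality is the symmetry of the noise under negation: \<open>\<theta>\<^sub>i - u\<^sub>i \<ge> \<theta>\<^sub>j - u\<^sub>j\<close>
  has probability \<open>1 / 2\<close>, since ties are null.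
\<close>

section \<open>The standard normal distribution\<close>

interpretation std_normal: prob_space std_normal
  by (rule prob_space_std_normal)

text \<open>For x \<ge> t \<ge> 0 the square of x is at least the sum of the squares of t and x - t.
  So beyond t the density is dominated by \<open>exp (- t\<^sup>2 / 2)\<close> times the density of
  a normal variable centred at t, whose total mass is 1.\<close>

lemma measure_std_normal_atLeast_le:
  assumes "t \<ge> 0"
  shows "measure std_normal {t..} \<le> exp (- t\<^sup>2 / 2)"
proof -
  interpret shifted: prob_space "density lborel (normal_density t 1)"
    by (rule prob_space_normal_density) simp
  have le: "std_normal_density x \<le> exp (- t\<^sup>2 / 2) * normal_density t 1 x" if "x \<ge> t" for x
  proof -
    have "2 * t * (x - t) \<ge> 0" using assms that by simp
    then have "- x\<^sup>2 / 2 \<le> - t\<^sup>2 / 2 + - (x - t)\<^sup>2 / 2"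
      by (simp add: power2_eq_square algebra_simps)
    then have "exp (- x\<^sup>2 / 2) \<le> exp (- t\<^sup>2 / 2) * exp (- (x - t)\<^sup>2 / 2)"
      by (simp flip: exp_add)
    then show ?thesis
      by (simp add: normal_density_def divide_simps)
  qed
  have "emeasure std_normal {t..} = (\<integral>\<^sup>+ x. std_normal_density x * indicator {t..} x \<partial>lborel)"
    by (simp add: std_normal_def emeasure_density ennreal_mult'' ennreal_indicator)
  also have "\<dots> \<le> (\<integral>\<^sup>+ x. ennreal (exp (- t\<^sup>2 / 2)) * normal_density t 1 x \<partial>lborel)"
    using le by (intro nn_integral_mono)
      (auto split: split_indicator simp flip: ennreal_mult'' intro!: ennreal_leI)
  also have "\<dots> = ennreal (exp (- t\<^sup>2 / 2)) * emeasure (density lborel (normal_density t 1)) UNIV"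
    by (simp add: nn_integral_cmult emeasure_density)
  also have "\<dots> = ennreal (exp (- t\<^sup>2 / 2))"
    using shifted.emeasure_space_1 by simp
  finally show ?thesis
    by (simp add: std_normal.emeasure_eq_measure)
qed

lemma measure_std_normal_interval_pos:
  assumes "a < b"
  shows "measure std_normal {a..b} > 0"
proof -
  have "{a..b} \<notin> null_sets std_normal"
  proof
    assume "{a..b} \<in> null_sets std_normal"
    then have "AE x in lborel. x \<in> {a..b} \<longrightarrow> ennreal (std_normal_density x) = 0"
      unfolding std_normal_def by (subst (asm) null_sets_density_iff) auto
    \<comment> \<open>The density vanishes nowhere, so a null interval would also be Lebesgue null,
      against its length b - a > 0.\<close>
    then have "AE x in lborel. x \<notin> {a..b}"
      by eventually_elim
        (metis ennreal_eq_0_iff normal_density_pos not_le zero_less_one)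
    then have "{a..b} \<in> null_sets lborel"
      by (subst AE_iff_null_sets) auto
    then show False using assms by (simp add: null_sets_def)
  qed
  then show ?thesis
    by (auto simp: null_sets_def std_normal.emeasure_eq_measure zero_less_measure_iff)
qed

text \<open>The density is even and Lebesgue measure is invariant under negation.\<close>

lemma distr_std_normal_uminus: "distr std_normal std_normal uminus = std_normal"
proof -
  have "distr std_normal std_normal uminus
      = distr (density lborel (\<lambda>x. ennreal (std_normal_density (- x)))) borel uminus"
    unfolding std_normal_def by (intro distr_cong) (auto simp: normal_density_def)
  also have "\<dots> = density (distr lborel borel uminus) std_normal_density"
    by (rule density_distr[symmetric]) auto
  finally show ?thesis
    by (simp add: lborel_distr_uminus std_normal_def)
qed

lemma measure_std_normal_atMost_le:
  assumes "t \<ge> 0"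
  shows "measure std_normal {..- t} \<le> exp (- t\<^sup>2 / 2)"
proof -
  have "measure std_normal {..- t} = measure (distr std_normal std_normal uminus) {..- t}"
    by (simp only: distr_std_normal_uminus)
  also have "\<dots> = measure std_normal {t..}"
    by (subst measure_distr)
      (auto simp: measurable_cong_sets[OF sets_std_normal sets_std_normal] intro!: arg_cong[where f = std_normal.prob])
  finally show ?thesis
    using measure_std_normal_atLeast_le[OF assms] by simp
qed

section \<open>The noise vector\<close>

abbreviation noise :: "nat \<Rightarrow> (nat \<Rightarrow> real) measure" where
  "noise N \<equiv> PiM {1..N} (\<lambda>_. std_normal)"

interpretation noise: prob_space "noise N" for N
  by (intro prob_space_PiM prob_space_std_normal)

lemma noise_component_measurable:
  assumes "i \<in> {1..N}"
  shows "(\<lambda>\<epsilon>. \<epsilon> i) \<in> borel_measurable (noise N)"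
  using measurable_component_singleton[OF assms, of "\<lambda>_. std_normal"]
  by (simp add: measurable_cong_sets[OF refl sets_std_normal])

lemma measure_noise_box:
  assumes "\<And>i. i \<in> {1..N} \<Longrightarrow> A i \<in> sets borel"
  shows "measure (noise N) (Pi\<^sub>E {1..N} A) = (\<Prod>i\<in>{1..N}. measure std_normal (A i))"
proof -
  interpret finite_product_prob_space "\<lambda>_::nat. std_normal" "{1..N}"
    by unfold_locales auto
  show ?thesis using assms by (intro finite_measure_PiM_emb) auto
qed

lemma measure_noise_component:
  assumes "i \<in> {1..N}" and "A \<in> sets borel"
  shows "measure (noise N) {\<epsilon> \<in> space (noise N). \<epsilon> i \<in> A} = measure std_normal A"
proof -
  have "measure std_normal A = measure (distr (noise N) std_normal (\<lambda>\<epsilon>. \<epsilon> i)) A"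
    using distr_PiM_component[of "{1..N}" "\<lambda>_. std_normal" i] prob_space_std_normal assms by simp
  also have "\<dots> = measure (noise N) ((\<lambda>\<epsilon>. \<epsilon> i) -` A \<inter> space (noise N))"
    using assms by (intro measure_distr) auto
  also have "(\<lambda>\<epsilon>. \<epsilon> i) -` A \<inter> space (noise N) = {\<epsilon> \<in> space (noise N). \<epsilon> i \<in> A}" by auto
  finally show ?thesis by simp
qed

text \<open>\<open>compose {1..N} uminus\<close> negates every arm's noise and stays
  \<open>undefined\<close> off the arms, so it maps the product space to itself; each factor is
  symmetric.\<close>

lemma distr_noise_uminus: "distr (noise N) (noise N) (compose {1..N} uminus) = noise N"
proof -
  have "distr (noise N) (noise N) (compose {1..N} uminus)
      = PiM {1..N} (\<lambda>_. distr std_normal std_normal uminus)"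
    by (intro distr_PiM_finite_prob_space' prob_space_std_normal)
       (auto simp: measurable_cong_sets[OF sets_std_normal sets_std_normal])
  then show ?thesis by (simp only: distr_std_normal_uminus)
qed

lemma distr_noise_permute:
  assumes "\<sigma> permutes {1..N}"
  shows "distr (noise N) (noise N) (\<lambda>\<epsilon>. \<lambda>n\<in>{1..N}. \<epsilon> (\<sigma> n)) = noise N"
  using distr_PiM_reindex[of "{1..N}" "\<lambda>_. std_normal" \<sigma> "{1..N}"] prob_space_std_normal
    permutes_inj_on[OF assms, of "{1..N}"] permutes_in_image[OF assms] by auto

section \<open>Comparison of perturbed rewards\<close>

lemma perturbed_reward_simps:
  "perturbed_reward \<alpha> (\<kappa>, u) \<epsilon> i = u i + \<epsilon> i / (real (\<kappa> i) + 1) powr \<alpha>"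
  by (simp add: perturbed_reward_def)

lemma sets_perturbed_reward_le:
  assumes "i \<in> {1..N}" "j \<in> {1..N}"
  shows "{\<epsilon> \<in> space (noise N). perturbed_reward \<alpha> S \<epsilon> j \<le> perturbed_reward \<alpha> S \<epsilon> i} \<in> noise.events N"
  by (intro borel_measurable_le perturbed_reward_measurable assms)

lemma sets_perturbed_reward_max:
  assumes "i \<in> {1..N}"
  shows "{\<epsilon> \<in> space (noise N). \<forall>j\<in>{1..N}. perturbed_reward \<alpha> S \<epsilon> j \<le> perturbed_reward \<alpha> S \<epsilon> i}
    \<in> noise.events N"
  by (intro sets.sets_Collect_finite_All' sets_perturbed_reward_le assms) (use assms in auto)

text \<open>A maximal arm beats any chosen rival, so an upper bound on its probability needs only
  one well-chosen comparison.\<close>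

lemma qcare_le_pairwise:
  assumes "i \<in> {1..N}" "j \<in> {1..N}"
  shows "qcare N \<alpha> S i
    \<le> \<P>(\<epsilon> in noise N. perturbed_reward \<alpha> S \<epsilon> j \<le> perturbed_reward \<alpha> S \<epsilon> i)"
  unfolding qcare_def
  by (intro noise.finite_measure_mono sets_perturbed_reward_le) (use assms in auto)

text \<open>Union bound: an arm that is not maximal is exceeded by some other arm.\<close>

lemma one_minus_qcare_le_sum:
  assumes "i \<in> {1..N}"
  shows "1 - qcare N \<alpha> S i
    \<le> (\<Sum>j\<in>{1..N} - {i}. \<P>(\<epsilon> in noise N. perturbed_reward \<alpha> S \<epsilon> i \<le> perturbed_reward \<alpha> S \<epsilon> j))"
proof -
  let ?\<theta> = "perturbed_reward \<alpha> S"
  let ?B = "\<lambda>j. {\<epsilon> \<in> space (noise N). ?\<theta> \<epsilon> i \<le> ?\<theta> \<epsilon> j}"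
  let ?A = "{\<epsilon> \<in> space (noise N). \<forall>j\<in>{1..N}. ?\<theta> \<epsilon> j \<le> ?\<theta> \<epsilon> i}"
  have B: "?B j \<in> noise.events N" if "j \<in> {1..N} - {i}" for j
    using that assms by (intro sets_perturbed_reward_le) auto
  have "1 - qcare N \<alpha> S i = measure (noise N) (space (noise N) - ?A)"
    unfolding qcare_def
    by (rule noise.prob_compl[symmetric]) (rule sets_perturbed_reward_max[OF assms])
  also have "\<dots> \<le> measure (noise N) (\<Union>j\<in>{1..N} - {i}. ?B j)"
    by (rule noise.finite_measure_mono) (auto intro!: sets.finite_UN B simp del: One_nat_def)
  also have "\<dots> \<le> (\<Sum>j\<in>{1..N} - {i}. measure (noise N) (?B j))"
    by (rule noise.finite_measure_subadditive_finite) (use B in blast)+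
  finally show ?thesis .
qed

lemma prob_trailing_arm_le:
  assumes ij: "i \<in> {1..N}" "j \<in> {1..N}" and "c \<ge> 0" and gap: "u i + c \<le> u j"
  shows "\<P>(\<epsilon> in noise N. perturbed_reward \<alpha> (\<kappa>, u) \<epsilon> j \<le> perturbed_reward \<alpha> (\<kappa>, u) \<epsilon> i)
    \<le> exp (- (c / 2 * (real (\<kappa> i) + 1) powr \<alpha>)\<^sup>2 / 2)
      + exp (- (c / 2 * (real (\<kappa> j) + 1) powr \<alpha>)\<^sup>2 / 2)"
proof -
  \<comment> \<open>The noise needed to shift the perturbed reward of arm l by half of the gap
    c.\<close>
  define s where "s l = c / 2 * (real (\<kappa> l) + 1) powr \<alpha>" for l
  have s: "s l \<ge> 0" for l using \<open>c \<ge> 0\<close> by (simp add: s_def)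
  let ?I = "{\<epsilon> \<in> space (noise N). \<epsilon> i \<in> {s i..}}"
  let ?J = "{\<epsilon> \<in> space (noise N). \<epsilon> j \<in> {..- s j}}"
  have [measurable]: "(\<lambda>\<epsilon>. \<epsilon> i) \<in> borel_measurable (noise N)" "(\<lambda>\<epsilon>. \<epsilon> j) \<in> borel_measurable (noise N)"
    using ij by (auto intro: noise_component_measurable)
  have "?I \<in> noise.events N" "?J \<in> noise.events N" by measurable
  moreover have "\<epsilon> i \<ge> s i \<or> \<epsilon> j \<le> - s j"
    if "perturbed_reward \<alpha> (\<kappa>, u) \<epsilon> j \<le> perturbed_reward \<alpha> (\<kappa>, u) \<epsilon> i" for \<epsilon>
  proof (rule ccontr)
    assume "\<not> ?thesis"
    \<comment> \<open>Each perturbation covers less than half of the gap, so the reward of i stays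
      below \<open>u i + c / 2\<close> and that of j above \<open>u j - c / 2\<close>, which is at
      least \<open>u i + c / 2\<close>.\<close>
    then have "\<epsilon> i / (real (\<kappa> i) + 1) powr \<alpha> < c / 2" "- (c / 2) < \<epsilon> j / (real (\<kappa> j) + 1) powr \<alpha>"
      by (auto simp: s_def divide_simps algebra_simps)
    then show False using that gap unfolding perturbed_reward_simps by linarith
  qed
  ultimately have "\<P>(\<epsilon> in noise N. perturbed_reward \<alpha> (\<kappa>, u) \<epsilon> j \<le> perturbed_reward \<alpha> (\<kappa>, u) \<epsilon> i)
      \<le> measure (noise N) (?I \<union> ?J)"
    by (intro noise.finite_measure_mono) auto
  also have "\<dots> \<le> measure (noise N) ?I + measure (noise N) ?J"
    by (rule measure_Un_le) fact+
  also have "\<dots> = measure std_normal {s i..} + measure std_normal {..- s j}"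
    using ij by (simp only: measure_noise_component atLeast_borel atMost_borel)
  also have "\<dots> \<le> exp (- (s i)\<^sup>2 / 2) + exp (- (s j)\<^sup>2 / 2)"
    by (intro add_mono measure_std_normal_atLeast_le measure_std_normal_atMost_le s)
  finally show ?thesis by (simp only: s_def)
qed

section \<open>From limits inferior to eventual bounds and divergence\<close>

lemma is_Omega_one_eventually_gt:
  assumes "is_Omega f (\<lambda>_. 1)"
  obtains c where "c > 0" "\<forall>\<^sub>F T in sequentially. f T > c"
proof -
  \<comment> \<open>The limit inferior may be infinite, so a real constant is chosen strictly
    between it and 0.\<close>
  obtain c where c: "0 < ereal c" "ereal c < liminf (\<lambda>T. ereal (f T / 1))"
    using assms ereal_dense2 unfolding is_Omega_def zero_ereal_def by blast
  from less_LiminfD[OF c(2)] c(1) show ?thesis by (intro that[of c]) auto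
qed

lemma is_omega_one_filterlim:
  assumes "is_omega f (\<lambda>_. 1)"
  shows "filterlim f at_top sequentially"
proof -
  have "((\<lambda>T. ereal (f T)) \<longlongrightarrow> \<infinity>) sequentially"
    using assms by (subst Liminf_PInfty) (auto simp: is_omega_def)
  then show ?thesis by (simp add: tendsto_PInfty_eq_at_top)
qed

section \<open>Properties of QCARE\<close>

text \<open>Permuting both the state and the noise only relabels the perturbed rewards, and the law
  of i.i.d. noise is invariant under permutation.\<close>

lemma qcare_anonymous: "anonymous N (qcare N \<alpha>)"
  unfolding anonymous_def
proof (intro allI impI)
  fix \<sigma> i and \<kappa> :: "nat \<Rightarrow> nat" and u :: "nat \<Rightarrow> real"
  assume \<sigma>: "\<sigma> permutes {1..N}" and i: "i \<in> {1..N}"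
  let ?r = "\<lambda>\<epsilon>. \<lambda>n\<in>{1..N}. (\<epsilon> (\<sigma> n) :: real)"
  let ?\<theta> = "perturbed_reward \<alpha> (\<kappa>, u)" and ?\<theta>' = "perturbed_reward \<alpha> (\<kappa> \<circ> \<sigma>, u \<circ> \<sigma>)"
  let ?A = "{\<epsilon> \<in> space (noise N). \<forall>j\<in>{1..N}. ?\<theta>' \<epsilon> j \<le> ?\<theta>' \<epsilon> i}"
  have in_N: "\<sigma> n \<in> {1..N}" if "n \<in> {1..N}" for n
    using permutes_in_image[OF \<sigma>] that by blast
  have r: "?r \<in> measurable (noise N) (noise N)"
    by (intro measurable_restrict measurable_component_singleton in_N)
  have \<theta>: "?\<theta>' (?r \<epsilon>) n = ?\<theta> \<epsilon> (\<sigma> n)" if "n \<in> {1..N}" for n \<epsilon>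
    using that by (simp add: perturbed_reward_simps)
  have "qcare N \<alpha> (\<kappa> \<circ> \<sigma>, u \<circ> \<sigma>) i = measure (distr (noise N) (noise N) ?r) ?A"
    by (simp only: qcare_def distr_noise_permute[OF \<sigma>])
  also have "\<dots> = measure (noise N) (?r -` ?A \<inter> space (noise N))"
    using r sets_perturbed_reward_max[OF i] by (rule measure_distr)
  also have "?r -` ?A \<inter> space (noise N)
      = {\<epsilon> \<in> space (noise N). \<forall>j\<in>{1..N}. ?\<theta> \<epsilon> (\<sigma> j) \<le> ?\<theta> \<epsilon> (\<sigma> i)}"
    using measurable_space[OF r] \<theta> i by auto
  \<comment> \<open>As j runs over the arms, so does \<open>\<sigma> j\<close>.\<close>
  also have "\<dots> = {\<epsilon> \<in> space (noise N). \<forall>j\<in>\<sigma> ` {1..N}. ?\<theta> \<epsilon> j \<le> ?\<theta> \<epsilon> (\<sigma> i)}"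
    by auto
  also have "measure (noise N) \<dots> = qcare N \<alpha> (\<kappa>, u) (\<sigma> i)"
    by (simp only: permutes_image[OF \<sigma>] qcare_def)
  finally show "qcare N \<alpha> (\<kappa> \<circ> \<sigma>, u \<circ> \<sigma>) i = qcare N \<alpha> (\<kappa>, u) (\<sigma> i)" .
qed

lemma qcare_recurrent:
  assumes "N \<ge> 1"
  shows "recurrent N (qcare N \<alpha>)"
  unfolding recurrent_def
proof (intro allI impI)
  fix k :: nat and v :: real
  \<comment> \<open>Noise b lifts arm 1 by exactly 1, the width of the reward range.\<close>
  define b where "b = (real k + 1) powr \<alpha>"
  \<comment> \<open>On this box arm 1 reaches at least v + 1 \<ge> 1, while every other arm stays at
    or below its own reward, hence at most 1.\<close>
  define A where "A = (\<lambda>i::nat. if i = 1 then {b..b + 1} else {- 1..0::real})"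
  have b: "b > 0" by (simp add: b_def)
  have one: "1 \<in> {1..N}" using assms by simp
  assume v: "v \<in> {0..1}"
  show "\<exists>\<epsilon>>0. \<forall>\<kappa> u. (\<kappa>, u) \<in> states N \<longrightarrow> \<kappa> 1 = k \<longrightarrow> u 1 = v \<longrightarrow> \<epsilon> \<le> qcare N \<alpha> (\<kappa>, u) 1"
  \<comment> \<open>The box is fixed by N, \<alpha> and k, so its probability is a bound uniform in
    the states of the other arms.\<close>
  proof (intro exI[of _ "measure (noise N) (Pi\<^sub>E {1..N} A)"] conjI allI impI)
    have "measure (noise N) (Pi\<^sub>E {1..N} A) = (\<Prod>i\<in>{1..N}. measure std_normal (A i))"
      by (rule measure_noise_box) (simp add: A_def)
    also have "\<dots> > 0"
      by (intro prod_pos ballI) (auto simp: A_def intro!: measure_std_normal_interval_pos)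
    finally show "measure (noise N) (Pi\<^sub>E {1..N} A) > 0" .
  next
    fix \<kappa> u assume S: "(\<kappa>, u) \<in> states N" "\<kappa> 1 = k" "u 1 = v"
    have max: "perturbed_reward \<alpha> (\<kappa>, u) \<epsilon> j \<le> perturbed_reward \<alpha> (\<kappa>, u) \<epsilon> 1"
      if "\<epsilon> \<in> Pi\<^sub>E {1..N} A" "j \<in> {1..N}" for \<epsilon> j
    proof (cases "j = 1")
      case False
      have "u j \<le> 1" using S(1) that(2) by (auto simp: states_def rewards_def PiE_def Pi_def)
      moreover have "\<epsilon> j \<le> 0" using PiE_mem[OF that] False by (simp add: A_def)
      then have "\<epsilon> j / (real (\<kappa> j) + 1) powr \<alpha> \<le> 0" by (simp add: divide_nonpos_pos)
      moreover have "\<epsilon> 1 \<ge> b" using PiE_mem[OF that(1) one] by (simp add: A_def)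
      then have "1 \<le> \<epsilon> 1 / b" using b by simp
      ultimately have "u j + \<epsilon> j / (real (\<kappa> j) + 1) powr \<alpha> \<le> v + \<epsilon> 1 / b" using v by auto
      then show ?thesis by (simp only: perturbed_reward_simps b_def S)
    qed simp
    show "measure (noise N) (Pi\<^sub>E {1..N} A) \<le> qcare N \<alpha> (\<kappa>, u) 1"
      unfolding qcare_def
    proof (rule noise.finite_measure_mono)
      show "Pi\<^sub>E {1..N} A \<subseteq> {\<epsilon> \<in> space (noise N).
          \<forall>j\<in>{1..N}. perturbed_reward \<alpha> (\<kappa>, u) \<epsilon> j \<le> perturbed_reward \<alpha> (\<kappa>, u) \<epsilon> 1}"
        using max by (auto simp: space_PiM PiE_def)
    qed (rule sets_perturbed_reward_max[OF one])
  qed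
qed

text \<open>By the union bound it suffices that each rival beats arm 1 with vanishing probability.
  The gap stays above a constant while the noise scales shrink to 0, so both Gaussian tails
  vanish.\<close>

lemma qcare_leading_arm_convergent:
  assumes "N \<ge> 1" "\<alpha> > 0"
  shows "leading_arm_convergent N (qcare N \<alpha>)"
  unfolding leading_arm_convergent_def
proof (intro allI impI)
  fix \<kappa> :: "nat \<Rightarrow> nat \<Rightarrow> nat" and u :: "nat \<Rightarrow> nat \<Rightarrow> real"
  assume \<kappa>: "\<forall>i\<in>{1..N}. is_omega (\<lambda>T. real (\<kappa> T i)) (\<lambda>_. 1)"
    and u: "\<forall>i\<in>{2..N}. is_Omega (\<lambda>T. u T 1 - u T i) (\<lambda>_. 1)"
  let ?p = "\<lambda>T i. \<P>(\<epsilon> in noise N.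
      perturbed_reward \<alpha> (\<kappa> T, u T) \<epsilon> 1 \<le> perturbed_reward \<alpha> (\<kappa> T, u T) \<epsilon> i)"
  have one: "1 \<in> {1..N}" using assms by simp
  have tail: "(\<lambda>T. exp (- (c / 2 * (real (\<kappa> T i) + 1) powr \<alpha>)\<^sup>2 / 2)) \<longlonglongrightarrow> 0"
    if "c > 0" "i \<in> {1..N}" for c i
  proof -
    have "((\<lambda>x. exp (- (c / 2 * (x + 1) powr \<alpha>)\<^sup>2 / 2)) \<longlongrightarrow> 0) at_top"
      using \<open>\<alpha> > 0\<close> \<open>c > 0\<close> by real_asymp
    from filterlim_compose[OF this is_omega_one_filterlim[OF \<kappa>[rule_format, OF that(2)]]]
    show ?thesis .
  qed
  have "(\<lambda>T. ?p T i) \<longlonglongrightarrow> 0" if i: "i \<in> {1..N} - {1}" for i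
  proof -
    from i have "i \<in> {2..N}" by auto
    \<comment> \<open>The constant may depend on the rival i, which is harmless in a finite
      sum.\<close>
    with u obtain c where c: "c > 0" "\<forall>\<^sub>F T in sequentially. u T 1 - u T i > c"
      using is_Omega_one_eventually_gt by blast
    let ?e = "\<lambda>T i. exp (- (c / 2 * (real (\<kappa> T i) + 1) powr \<alpha>)\<^sup>2 / 2)"
    from c(2) have "\<forall>\<^sub>F T in sequentially. ?p T i \<le> ?e T i + ?e T 1"
      by eventually_elim (rule prob_trailing_arm_le, use one i c(1) in auto)
    moreover have "(\<lambda>T. ?e T i + ?e T 1) \<longlonglongrightarrow> 0"
      using tendsto_add[OF tail[OF c(1), of i] tail[OF c(1) one]] i by simp
    ultimately show ?thesis
      by (rule real_tendsto_sandwich[OF always_eventually _ tendsto_const, rotated]) (rule allI measure_nonneg)+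
  qed
  then have sum: "(\<lambda>T. \<Sum>i\<in>{1..N} - {1}. ?p T i) \<longlonglongrightarrow> 0"
    by (rule tendsto_null_sum)
  have "qcare N \<alpha> S 1 \<le> 1" for S
    unfolding qcare_def by (rule noise.prob_le_1)
  then have "(\<lambda>T. 1 - qcare N \<alpha> (\<kappa> T, u T) 1) \<longlonglongrightarrow> 0"
    by (intro real_tendsto_sandwich[OF _ _ tendsto_const sum] always_eventually allI
        one_minus_qcare_le_sum[OF one]) simp
  then show "is_o (\<lambda>T. 1 - qcare N \<alpha> (\<kappa> T, u T) 1) (\<lambda>_. 1)"
    unfolding is_o_def by (intro lim_imp_Limsup) (auto simp: zero_ereal_def)
qed

text \<open>Zero rewards leave only the scaled noise. Negating it exchanges the two opposite
  comparisons, so they are equally likely; as ties are null, their probabilities sum to 1.\<close>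

lemma prob_centered_perturbation_eq_half:
  assumes ij: "i \<in> {1..N}" "j \<in> {1..N}" "i \<noteq> j"
  shows "\<P>(\<epsilon> in noise N. perturbed_reward \<alpha> (\<kappa>, \<lambda>_. 0) \<epsilon> j \<le> perturbed_reward \<alpha> (\<kappa>, \<lambda>_. 0) \<epsilon> i) = 1 / 2"
proof -
  let ?\<theta> = "perturbed_reward \<alpha> (\<kappa>, \<lambda>_. 0)" and ?r = "compose {1..N} (uminus :: real \<Rightarrow> real)"
  let ?A = "\<lambda>i j. {\<epsilon> \<in> space (noise N). ?\<theta> \<epsilon> j \<le> ?\<theta> \<epsilon> i}"
  have r: "?r \<in> measurable (noise N) (noise N)"
    unfolding compose_def
    by (intro measurable_restrict)
      (simp add: measurable_cong_sets[OF refl sets_std_normal] noise_component_measurable)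
  have \<theta>: "?\<theta> (?r \<epsilon>) l = - ?\<theta> \<epsilon> l" if "l \<in> {1..N}" for \<epsilon> l
    using that by (simp add: perturbed_reward_simps compose_def)
  have "measure (noise N) (?A i j) = measure (distr (noise N) (noise N) ?r) (?A i j)"
    by (simp only: distr_noise_uminus)
  also have "\<dots> = measure (noise N) (?r -` ?A i j \<inter> space (noise N))"
    using r sets_perturbed_reward_le[OF ij(1,2)] by (rule measure_distr)
  also have "?r -` ?A i j \<inter> space (noise N) = ?A j i"
    using measurable_space[OF r] \<theta> ij by auto
  finally have "measure (noise N) (?A i j) = measure (noise N) (?A j i)" .
  \<comment> \<open>The reversed comparison differs from the complement only by the ties.\<close>
  moreover have "measure (noise N) (?A j i) = measure (noise N) (space (noise N) - ?A i j)"
    using perturbed_reward_no_ties[OF ij, of \<alpha> "(\<kappa>, \<lambda>_. 0)"] ij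
    by (intro noise.finite_measure_eq_AE sets.compl_sets sets_perturbed_reward_le)
       (auto elim!: eventually_mono)
  moreover have "\<dots> = 1 - measure (noise N) (?A i j)"
    by (rule noise.prob_compl) (rule sets_perturbed_reward_le[OF ij(1,2)])
  ultimately show ?thesis by simp
qed

lemma qcare_unradical:
  assumes "N > 1"
  shows "unradical N (qcare N \<alpha>)"
  unfolding unradical_def
proof (intro allI impI)
  fix \<kappa> :: "nat \<Rightarrow> nat" and u :: "nat \<Rightarrow> real"
  assume "u 1 \<le> Min (u ` {2..N})"
  moreover have "Min (u ` {2..N}) \<le> u 2" using assms by (intro Min_le) auto
  ultimately have le: "u 1 \<le> u 2" by simp
  have arms: "1 \<in> {1..N}" "2 \<in> {1..N}" "1 \<noteq> (2::nat)" using assms by auto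
  have "qcare N \<alpha> (\<kappa>, u) 1
      \<le> \<P>(\<epsilon> in noise N. perturbed_reward \<alpha> (\<kappa>, u) \<epsilon> 2 \<le> perturbed_reward \<alpha> (\<kappa>, u) \<epsilon> 1)"
    by (rule qcare_le_pairwise) fact+
  \<comment> \<open>Since \<open>u 1 \<le> u 2\<close>, arm 1 can catch up with arm 2 only if its
    perturbation is at least that of arm 2; removing the rewards enlarges the event.\<close>
  also have "\<dots> \<le> \<P>(\<epsilon> in noise N.
      perturbed_reward \<alpha> (\<kappa>, \<lambda>_. 0) \<epsilon> 2 \<le> perturbed_reward \<alpha> (\<kappa>, \<lambda>_. 0) \<epsilon> 1)"
    using le by (intro noise.finite_measure_mono sets_perturbed_reward_le arms)
      (auto simp: perturbed_reward_simps)
  also have "\<dots> = 1 / 2"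
    by (rule prob_centered_perturbation_eq_half) fact+
  finally show "qcare N \<alpha> (\<kappa>, u) 1 \<le> 1 / 2" .
qed

text \<open>With \<delta> = 1/2 and \<open>\<Delta> T = T powr - \<alpha>\<close>, arm 2 has fewer
  than T/2 pulls, so its noise scale is at least \<Delta> T. Noise of at least 1 on arm 2 then
  offsets the lead v of arm 1.\<close>

lemma qcare_exploratory:
  assumes "N > 1" "\<alpha> > 0"
  shows "exploratory N \<alpha> (qcare N \<alpha>)"
proof -
  \<comment> \<open>Arm 2 is lifted by at least its noise scale, and arm 1 is pushed strictly down,
    which makes the comparison strict. The box depends on N only, so p is a constant.\<close>
  define A where "A = (\<lambda>i::nat. if i = 1 then {- 2..- 1} else {1..2::real})"
  define p where "p = measure (noise N) (Pi\<^sub>E {1..N} A)"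
  have arms: "1 \<in> {1..N}" "2 \<in> {1..N}" using assms by auto
  have "p = (\<Prod>i\<in>{1..N}. measure std_normal (A i))"
    unfolding p_def by (rule measure_noise_box) (simp add: A_def)
  also have "\<dots> > 0"
    by (intro prod_pos ballI) (auto simp: A_def intro!: measure_std_normal_interval_pos)
  finally have p: "p > 0" .
  have Omega: "is_Omega (\<lambda>T. real T powr - \<alpha>) (\<lambda>T. real T powr - \<alpha>)"
  proof -
    \<comment> \<open>At T = 0 both powers are 0 and the quotient is 0; it equals 1 for all T >
      0.\<close>
    have "\<forall>\<^sub>F T in sequentially. ereal (real T powr - \<alpha> / real T powr - \<alpha>) = ereal 1"
      using eventually_gt_at_top[of 0] by eventually_elim simp
    from lim_imp_Liminf[OF _ tendsto_eventually[OF this]] show ?thesis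
      unfolding is_Omega_def by auto
  qed
  have bound: "p \<le> 1 - qcare N \<alpha> (\<kappa>, \<lambda>i\<in>{1..N}. if i = 1 then v else 0) 1"
    if T: "T \<ge> 2" and v: "v \<le> real T powr - \<alpha>"
      and \<kappa>: "real (\<Sum>i\<in>{2..N}. \<kappa> i) < 1 / 2 * real T" for T v \<kappa>
  proof -
    let ?\<theta> = "perturbed_reward \<alpha> (\<kappa>, \<lambda>i\<in>{1..N}. if i = 1 then v else 0)"
    let ?A = "{\<epsilon> \<in> space (noise N). \<forall>j\<in>{1..N}. ?\<theta> \<epsilon> j \<le> ?\<theta> \<epsilon> 1}"
    have "\<kappa> 2 \<le> (\<Sum>i\<in>{2..N}. \<kappa> i)"
      using arms by (intro member_le_sum) auto
    \<comment> \<open>T/2 + 1 \<le> T because T \<ge> 2.\<close>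
    then have "real (\<kappa> 2) + 1 \<le> real T" using T \<kappa> by linarith
    then have "(real (\<kappa> 2) + 1) powr \<alpha> \<le> real T powr \<alpha>"
      using assms by (intro powr_mono2) auto
    then have scale: "real T powr - \<alpha> \<le> 1 / (real (\<kappa> 2) + 1) powr \<alpha>"
      using T by (simp add: powr_minus divide_simps)
    have lt: "?\<theta> \<epsilon> 1 < ?\<theta> \<epsilon> 2" if \<epsilon>: "\<epsilon> \<in> Pi\<^sub>E {1..N} A" for \<epsilon>
    proof -
      have "\<epsilon> 1 \<le> - 1" "\<epsilon> 2 \<ge> 1"
        using PiE_mem[OF \<epsilon> arms(1)] PiE_mem[OF \<epsilon> arms(2)] by (auto simp: A_def)
      then have "\<epsilon> 1 / (real (\<kappa> 1) + 1) powr \<alpha> < 0"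
        "\<epsilon> 2 / (real (\<kappa> 2) + 1) powr \<alpha> \<ge> 1 / (real (\<kappa> 2) + 1) powr \<alpha>"
        by (auto intro: divide_neg_pos divide_right_mono)
      then show ?thesis using arms v scale by (simp add: perturbed_reward_simps)
    qed
    have "p \<le> measure (noise N) (space (noise N) - ?A)"
      unfolding p_def
    proof (rule noise.finite_measure_mono)
      have "Pi\<^sub>E {1..N} A \<subseteq> space (noise N)"
        unfolding space_PiM by (rule PiE_mono) simp
      moreover have "\<epsilon> \<notin> ?A" if "\<epsilon> \<in> Pi\<^sub>E {1..N} A" for \<epsilon>
      proof
        assume "\<epsilon> \<in> ?A"
        then have "\<forall>j\<in>{1..N}. ?\<theta> \<epsilon> j \<le> ?\<theta> \<epsilon> 1" by simp
        from bspec[OF this arms(2)] lt[OF that] show False by linarith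
      qed
      ultimately show "Pi\<^sub>E {1..N} A \<subseteq> space (noise N) - ?A"
        by (intro subsetI DiffI) (rule subsetD)
    qed (intro sets.compl_sets sets_perturbed_reward_max[OF arms(1)])
    also have "\<dots> = 1 - measure (noise N) ?A"
      by (rule noise.prob_compl) (rule sets_perturbed_reward_max[OF arms(1)])
    finally show ?thesis by (simp only: qcare_def)
  qed
  show ?thesis
    unfolding exploratory_def
  proof (intro exI[of _ p] conjI bexI[of _ "1 / 2"] exI[of _ "\<lambda>T. real T powr - \<alpha>"])
    show "\<forall>\<^sub>F T in sequentially. \<forall>v\<in>{0..1}. v \<le> real T powr - \<alpha> \<longrightarrow>
        (\<forall>\<kappa>\<in>pull_counts N. real (\<Sum>i\<in>{2..N}. \<kappa> i) < 1 / 2 * real T \<longrightarrow>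
          p \<le> 1 - qcare N \<alpha> (\<kappa>, \<lambda>i\<in>{1..N}. if i = 1 then v else 0) 1)"
      using eventually_ge_at_top[of 2] by eventually_elim (intro ballI impI bound)
  qed (use p Omega in simp_all)
qed

text \<open>Compare arm 1 with arm j alone. The pull counts make each Gaussian exponent at least a
  constant times \<open>ln T powr q\<close> with q > 1, which outgrows \<open>ln T\<close>, so each
  of the two tails is at most 1/T.\<close>

lemma qcare_irreversible:
  assumes "\<alpha> > 0"
  shows "irreversible N \<alpha> (qcare N \<alpha>)"
  unfolding irreversible_def
proof (intro ballI allI impI)
  fix \<delta> j and \<kappa> :: "nat \<Rightarrow> nat \<Rightarrow> nat" and u :: "nat \<Rightarrow> nat \<Rightarrow> real"
  define r where "r = 1 / (2 * \<alpha> - \<delta>)"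
  \<comment> \<open>q = 2\<alpha>/(2\<alpha> - \<delta>), the exponent of \<open>ln T\<close> in the
    square of \<open>L T powr \<alpha>\<close>; it exceeds 1 because \<delta> > 0.\<close>
  define q where "q = r * \<alpha> * 2"
  define L where "L = (\<lambda>T. ln (real T) powr r)"
  assume \<delta>: "\<delta> \<in> {0<..<2 * \<alpha>}" and j: "j \<in> {2..N}"
    and u: "is_Omega (\<lambda>T. u T j - u T 1) (\<lambda>_. 1)"
    and "\<forall>\<^sub>F T in sequentially. real (\<kappa> T 1) \<ge> ln (real T) powr (1 / (2 * \<alpha> - \<delta>)) \<and>
           real (\<kappa> T j) \<ge> ln (real T) powr (1 / (2 * \<alpha> - \<delta>))"
  then have \<kappa>: "\<forall>\<^sub>F T in sequentially. real (\<kappa> T 1) \<ge> L T \<and> real (\<kappa> T j) \<ge> L T"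
    by (simp add: L_def r_def)
  have arms: "1 \<in> {1..N}" "j \<in> {1..N}" using j by auto
  have r: "r > 0" using \<delta> by (simp add: r_def)
  have q: "q > 1" using \<delta> by (simp add: q_def r_def field_simps)
  obtain c where c: "c > 0" "\<forall>\<^sub>F T in sequentially. u T j - u T 1 > c"
    using is_Omega_one_eventually_gt[OF u] by blast
  \<comment> \<open>As q > 1, the power wins however small the gap c is.\<close>
  have "\<forall>\<^sub>F T in sequentially. (c / 2)\<^sup>2 * ln (real T) powr q / 2 \<ge> ln (real T)"
    using c(1) q by real_asymp
  \<comment> \<open>The two tails add up to 2/T, and the factor 2 is absorbed by the diverging L
    T.\<close>
  moreover have "\<forall>\<^sub>F T in sequentially. L T \<ge> 2"
    unfolding L_def using r by real_asymp
  ultimately show "\<forall>\<^sub>F T in sequentially.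
      qcare N \<alpha> (\<kappa> T, u T) 1 \<le> ln (real T) powr (1 / (2 * \<alpha> - \<delta>)) / real T"
    using c(2) \<kappa> eventually_gt_at_top[of 1]
  proof eventually_elim
    case (elim T)
    have tail: "exp (- (c / 2 * (real (\<kappa> T l) + 1) powr \<alpha>)\<^sup>2 / 2) \<le> 1 / real T"
      if "real (\<kappa> T l) \<ge> L T" for l
    proof -
      have "L T powr \<alpha> \<le> (real (\<kappa> T l) + 1) powr \<alpha>"
        using that assms by (intro powr_mono2) (auto simp: L_def)
      then have le: "(c / 2 * L T powr \<alpha>)\<^sup>2 \<le> (c / 2 * (real (\<kappa> T l) + 1) powr \<alpha>)\<^sup>2"
        using c(1) by (intro power_mono mult_left_mono) auto
      have L: "(L T powr \<alpha>)\<^sup>2 = ln (real T) powr q"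
        by (simp add: L_def q_def powr_powr flip: powr_numeral powr_realpow)
      have "ln (real T) \<le> (c / 2 * (real (\<kappa> T l) + 1) powr \<alpha>)\<^sup>2 / 2"
        using elim(1) le[unfolded power_mult_distrib[of "c / 2" "L T powr \<alpha>"] L] by linarith
      then have "exp (- (c / 2 * (real (\<kappa> T l) + 1) powr \<alpha>)\<^sup>2 / 2) \<le> exp (- ln (real T))"
        by simp
      \<comment> \<open>This needs T > 0: \<open>ln 0\<close> and \<open>1 / 0\<close> are both 0,
        so the identity fails at T = 0.\<close>
      also have "\<dots> = 1 / real T" using elim by (simp add: exp_minus divide_simps)
      finally show ?thesis .
    qed
    have "qcare N \<alpha> (\<kappa> T, u T) 1
        \<le> \<P>(\<epsilon> in noise N. perturbed_reward \<alpha> (\<kappa> T, u T) \<epsilon> j \<le> perturbed_reward \<alpha> (\<kappa> T, u T) \<epsilon> 1)"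
      by (rule qcare_le_pairwise) fact+
    also have "\<dots> \<le> exp (- (c / 2 * (real (\<kappa> T 1) + 1) powr \<alpha>)\<^sup>2 / 2)
        + exp (- (c / 2 * (real (\<kappa> T j) + 1) powr \<alpha>)\<^sup>2 / 2)"
      by (rule prob_trailing_arm_le) (use arms c(1) elim in auto)
    also have "\<dots> \<le> 1 / real T + 1 / real T"
      using elim by (intro add_mono tail) auto
    also have "\<dots> \<le> L T / real T"
      using elim by (simp add: divide_simps)
    finally show ?case by (simp add: L_def r_def)
  qed
qed

theorem proposition3:
  fixes N :: nat and \<alpha> :: real
  assumes "N > 1" and "\<alpha> > 0"
  shows "anonymous N (qcare N \<alpha>) \<and> recurrent N (qcare N \<alpha>) \<and>
         leading_arm_convergent N (qcare N \<alpha>) \<and> unradical N (qcare N \<alpha>) \<and>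
         (\<alpha> < 1 / 2 \<longrightarrow> exploratory N \<alpha> (qcare N \<alpha>)) \<and>
         (\<alpha> > 1 / 2 \<longrightarrow> irreversible N \<alpha> (qcare N \<alpha>))"
  using assms by (simp add: qcare_anonymous qcare_recurrent qcare_leading_arm_convergent
      qcare_unradical qcare_exploratory qcare_irreversible)

end
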